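(* Let $\mathcal{F}=(a_{i_1\dots i_d})_{i_1,\dots,i_d\in[n]}$ be a nonnegative $n$-dimensional tensor (of order $d$). Every nonnegative tensor with the same pattern as $\mathcal{F}$ has a positive eigenvector if and only if the directed graph $\mathcal{G}_\infty(\mathcal{F})$ has a unique final class $C$ and $\operatorname{reach}(C,\mathcal{H}_\infty(\mathcal{F}))=[n]$.
   Context: $[n]=\{1,\dots,n\}$. A $d$-order $n$-dimensional tensor $\mathcal{F}$ is given by $n^d$ real entries $a_{i_1\dots i_d}$, and is nonnegative if all entries are $\ge0$. It defines $f:\mathbb{R}^n\to\mathbb{R}^n$ by $f_i(x)=\sum_{1\le i_2,\dots,i_d\le n}a_{i\,i_2\dots i_d}\,x_{i_2}\cdots x_{i_d}$. A positive eigenvector of a nonnegative tensor is a vector $u\in\mathbb{R}^n$ with all entries positive such that, for some positive eigenvalue $\lambda>0$, $f_i(u)=\lambda u_i^{d-1}$ for all $i\in[n]$. The pattern of $\mathcal{F}$ is the set of multi-indices $(i_1,\dots,i_d)\in[n]^d$ with $a_{i_1\dots i_d}>0$. $\mathcal{G}_\infty(\mathcal{F})$ is the directed graph with node set $[n]$ and an edge from $i$ to $j$ if $\lim_{\alpha\to+\infty}f_i(\exp(\alpha e_{\{j\}}))=+\infty$, equivalently if there exist indices $(i_2,\dots,i_d)$ with $j\in\{i_2,\dots,i_d\}$ and $a_{i\,i_2\dots i_d}>0$. Here $e_K\in\mathbb{R}^n$ has entries $1$ on $K$ and $0$ elsewhere, and $\exp$ acts componentwise. A final class of a directed graph is a nonempty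 set $C$ of nodes such that every two nodes of $C$ are connected by a directed path and every path starting from a node of $C$ remains in $C$. A directed hypergraph has nodes and hyperarcs, each an ordered pair (tail, head) of disjoint nonempty sets of nodes. A node $j$ is reachable from a set $I$ of nodes if (recursively) $j\in I$ or there is a hyperarc $(\mathbf{t},\mathbf{h})$ with $j\in\mathbf{h}$ and every node of $\mathbf{t}$ reachable from $I$; $\operatorname{reach}(I,\mathcal{H})$ is the set of nodes reachable from $I$ in $\mathcal{H}$. $\mathcal{H}_\infty(\mathcal{F})$ is the directed hypergraph with node set $[n]$ whose hyperarcs are the pairs $(J,\{i\})$ with $J\subset[n]$, $i\notin J$ and $\lim_{\alpha\to-\infty}f_i(\exp(\alpha e_J))=0$; equivalently, $i\notin J$ and for all $(i_2,\dots,i_d)\in[n]^{d-1}$, $a_{i\,i_2\dots i_d}>0$ implies $J\cap\{i_2,\dots,i_d\}\ne\emptyset$.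
   Formalization: The formal theorem also assumes that for each i some entry a_{i i_2...i_d} is positive; without this the claim fails, e.g. for the zero tensor with n=1, where {1} is the unique final class and its reach is [1], but no positive eigenvalue exists. *)

theory Defs
  imports "HOL-Analysis.Analysis"
begin

(* The index set [n] is the universe of a finite type 'n. A tensor of order d is a function on
   index lists, of which only the values on lists of length d matter. *)
type_synonym 'n tensor = "'n list \<Rightarrow> real"

definition nonneg_tensor :: "nat \<Rightarrow> 'n tensor \<Rightarrow> bool" where
  "nonneg_tensor d F \<longleftrightarrow> (\<forall>is. length is = d \<longrightarrow> 0 \<le> F is)"

definition pattern :: "nat \<Rightarrow> 'n tensor \<Rightarrow> 'n list set" where
  "pattern d F = {is. length is = d \<and> 0 < F is}"

(* For a nonnegative F this says that no coordinate of tensor_map d F is identically zero, i.e.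
   that tensor_map d F maps the open positive orthant into itself. *)
definition no_zero_row :: "nat \<Rightarrow> 'n tensor \<Rightarrow> bool" where
  "no_zero_row d F \<longleftrightarrow> (\<forall>i. \<exists>is. i # is \<in> pattern d F)"

definition tensor_map :: "nat \<Rightarrow> 'n::finite tensor \<Rightarrow> real ^ 'n \<Rightarrow> real ^ 'n" where
  "tensor_map d F x =
     (\<chi> i. \<Sum>is | length is = d - 1. F (i # is) * (\<Prod>k<d - 1. x $ (is ! k)))"

definition positive_eigenvector :: "nat \<Rightarrow> 'n::finite tensor \<Rightarrow> real ^ 'n \<Rightarrow> bool" where
  "positive_eigenvector d F u \<longleftrightarrow>
     (\<forall>i. 0 < u $ i) \<and>
     (\<exists>\<mu>>0. \<forall>i. tensor_map d F u $ i = \<mu> * (u $ i) ^ (d - 1))"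

(* exp (\<alpha> e_K), with exp applied componentwise *)
definition exp_ray :: "real \<Rightarrow> 'n::finite set \<Rightarrow> real ^ 'n" where
  "exp_ray \<alpha> K = (\<chi> j. exp (\<alpha> * indicator K j))"

(* A directed graph on 'n is its edge relation; a directed hypergraph on 'n is its set of
   hyperarcs (tail, head). All elements of 'n are nodes. *)

definition G_inf :: "nat \<Rightarrow> 'n::finite tensor \<Rightarrow> ('n \<times> 'n) set" where
  "G_inf d F =
     {(i, j). filterlim (\<lambda>\<alpha>. tensor_map d F (exp_ray \<alpha> {j}) $ i) at_top at_top}"

definition H_inf :: "nat \<Rightarrow> 'n::finite tensor \<Rightarrow> ('n set \<times> 'n set) set" where
  "H_inf d F =
     {(J, {i}) | J i. J \<noteq> {} \<and> i \<notin> J \<and>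
        ((\<lambda>\<alpha>. tensor_map d F (exp_ray \<alpha> J) $ i) \<longlongrightarrow> 0) at_bot}"

(* Paths may have length zero, so a single node without successors is a final class. *)
definition final_class :: "('n \<times> 'n) set \<Rightarrow> 'n set \<Rightarrow> bool" where
  "final_class E C \<longleftrightarrow> C \<noteq> {} \<and>
     (\<forall>i\<in>C. \<forall>j\<in>C. (i, j) \<in> E\<^sup>*) \<and>
     (\<forall>i\<in>C. \<forall>j. (i, j) \<in> E\<^sup>* \<longrightarrow> j \<in> C)"

inductive_set reach :: "'n set \<Rightarrow> ('n set \<times> 'n set) set \<Rightarrow> 'n set"
  for I :: "'n set" and H :: "('n set \<times> 'n set) set" where
  start: "j \<in> I \<Longrightarrow> j \<in> reach I H"
| hyperarc: "(t, h) \<in> H \<Longrightarrow> j \<in> h \<Longrightarrow> \<forall>k\<in>t. k \<in> reach I H \<Longrightarrow> j \<in> reach I H"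

end

theory Submission
  imports Defs
begin

text \<open>
  Both \<^const>\<open>G_inf\<close> and \<^const>\<open>H_inf\<close> can be read off from the pattern: there is an edge from
  \<open>i\<close> to \<open>j\<close> iff \<open>j\<close> occurs in some monomial of \<open>f\<^sub>i\<close>, and a hyperarc from \<open>J\<close> to \<open>i\<close> iff every
  monomial of \<open>f\<^sub>i\<close> contains a variable from \<open>J\<close>. Write \<open>m = d - 1\<close> for the degree of \<open>f\<close>.

  Suppose that all tensors with the pattern have positive eigenvectors. On a final class \<open>C\<close> the map
  depends on the variables of \<open>C\<close> only, so comparing two positive eigenvectors by their largest ratio
  on \<open>C\<close> shows that the rows in \<open>C\<close> alone determine the eigenvalue (\<open>eigenvalue_unique\<close>). Doubling
  the rows in one of two disjoint final classes would therefore double and preserve the eigenvalue.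
  If the set \<open>S\<close> of nodes outside the reach of \<open>C\<close> were nonempty, each \<open>f\<^sub>i\<close> with \<open>i \<in> S\<close> would have
  a monomial in the variables of \<open>S\<close> alone. At the smallest entry of an eigenvector on \<open>S\<close> this
  bounds the eigenvalue below by a coefficient, so multiplying the rows in \<open>S\<close> by a large constant
  makes it exceed the value imposed by \<open>C\<close>.

  Conversely, in coordinates \<open>x = log u\<close> an eigenvector solves, up to a constant \<open>K\<close> that depends on
  the coefficients only, the max-plus equation \<open>m x\<^sub>i = max (x\<^sub>i\<^sub>2 + \<dots> + x\<^sub>i\<^sub>d)\<close> over the monomials of
  \<open>f\<^sub>i\<close>. Normalise \<open>min x = 0\<close>. If \<open>x\<^sub>i\<close> is bounded, every monomial of \<open>f\<^sub>i\<close> has a bounded sum, so \<open>x\<close>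
  stays bounded along the edges leaving a minimiser, hence on the unique final class \<open>C\<close>
  (\<open>bounded_along_path\<close>). If \<open>X = max x\<close> and a variable in each monomial of \<open>f\<^sub>i\<close> is at most a fixed
  fraction \<open>\<theta> < 1\<close> of \<open>X\<close> up to a constant, then so is \<open>x\<^sub>i\<close>, with a worse fraction
  \<open>(\<theta> + m - 1) / m < 1\<close>; following hyperarcs from \<open>C\<close> this holds at all nodes
  (\<open>contracted_on_reach\<close>), in particular where \<open>x\<^sub>i = X\<close>, and so \<open>X\<close> is bounded.

  To turn this bound into existence, the map \<open>x \<mapsto> T x / m - min (T x / m)\<close>, where \<open>T\<close> is \<open>f\<close> in
  logarithmic coordinates, is cut off at a height \<open>W\<close> and Brouwer's theorem is applied on the cube
  \<open>[0, W]\<^sup>n\<close>. The estimates use the upper half of the max-plus equation everywhere, and the lower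
  half only at nodes where \<open>x\<close> is small. They therefore survive the truncation, with a bound
  independent of \<open>W\<close>; for large \<open>W\<close> nothing is cut off and the fixed point is an eigenvector.
\<close>

section \<open>Tensor maps through the positive monomials\<close>

text \<open>The positive monomials of the coordinate \<open>f\<^sub>i\<close>, as lists of variables.\<close>

definition row_support :: "nat \<Rightarrow> 'n tensor \<Rightarrow> 'n \<Rightarrow> 'n list set" where
  "row_support d F i = {is. i # is \<in> pattern d F}"

definition exp_vec :: "real ^ 'n \<Rightarrow> real ^ 'n::finite" where
  "exp_vec x = (\<chi> j. exp (x $ j))"

locale nonzero_row_tensor =
  fixes d :: nat and F :: "'n::finite tensor"
  assumes order_pos: "d \<ge> 1"
    and nonneg: "nonneg_tensor d F"
    and rows: "no_zero_row d F"
begin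

lemma row_supportD:
  assumes "is \<in> row_support d F i"
  shows "length is = d - 1" "0 < F (i # is)"
  using assms by (auto simp: row_support_def pattern_def)

lemma finite_row_support [simp]: "finite (row_support d F i)"
  by (rule finite_subset[OF _ finite_lists_length_eq[of UNIV "d - 1"]])
    (auto dest: row_supportD)

lemma row_support_nonempty: "row_support d F i \<noteq> {}"
  using rows by (auto simp: row_support_def no_zero_row_def)

lemma tensor_map_row_support:
  "tensor_map d F x $ i =
     (\<Sum>is\<in>row_support d F i. F (i # is) * (\<Prod>k<d - 1. x $ (is ! k)))"
proof -
  have "F (i # is) = 0" if "length is = d - 1" "is \<notin> row_support d F i" for "is"
  proof -
    have "length (i # is) = d"
      using that order_pos by simp
    then show ?thesis
      using that nonneg
      by (force simp: row_support_def pattern_def nonneg_tensor_def order.order_iff_strict)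
  qed
  then show ?thesis
    unfolding tensor_map_def
    using finite_lists_length_eq[of "UNIV :: 'n set" "d - 1"]
    by (auto intro!: sum.mono_neutral_right dest: row_supportD)
qed

lemma monomial_le_tensor_map:
  assumes "is \<in> row_support d F i" "\<And>j. 0 \<le> x $ j"
  shows "F (i # is) * (\<Prod>k<d - 1. x $ (is ! k)) \<le> tensor_map d F x $ i"
  unfolding tensor_map_row_support
  by (rule member_le_sum[OF assms(1)])
    (auto intro!: mult_nonneg_nonneg prod_nonneg assms(2) dest: row_supportD less_imp_le)

lemma tensor_map_exp_vec:
  "tensor_map d F (exp_vec x) $ i =
     (\<Sum>is\<in>row_support d F i. F (i # is) * exp (\<Sum>k<d - 1. x $ (is ! k)))"
  by (simp add: tensor_map_row_support exp_vec_def exp_sum)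

lemma tensor_map_exp_vec_pos: "0 < tensor_map d F (exp_vec x) $ i"
  unfolding tensor_map_exp_vec
  by (rule sum_pos) (auto simp: row_support_nonempty dest: row_supportD)

lemma tensor_map_exp_ray:
  "tensor_map d F (exp_ray \<alpha> K) $ i =
     (\<Sum>is\<in>row_support d F i. F (i # is) * exp (\<alpha> * (\<Sum>k<d - 1. indicator K (is ! k))))"
  unfolding tensor_map_row_support sum_distrib_left
  by (subst exp_sum) (simp_all add: exp_ray_def)

lemma sum_indicator_nth_pos_iff:
  assumes "length is = m"
  shows "0 < (\<Sum>k<m. indicator K (is ! k) :: real) \<longleftrightarrow> K \<inter> set is \<noteq> {}"
proof -
  have "(\<Sum>k<m. indicator K (is ! k) :: real) = 0 \<longleftrightarrow> K \<inter> set is = {}"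
    using assms by (subst sum_nonneg_eq_0_iff) (auto simp: indicator_def set_conv_nth)
  moreover have "0 \<le> (\<Sum>k<m. indicator K (is ! k) :: real)"
    by (simp add: sum_nonneg)
  ultimately show ?thesis
    by linarith
qed

lemma sum_indicator_nth_zero:
  assumes "length is = m" "K \<inter> set is = {}"
  shows "(\<Sum>k<m. indicator K (is ! k) :: real) = 0"
  using assms by (auto simp: indicator_def set_conv_nth intro!: sum.neutral)

text \<open>
  Along the ray \<open>exp (\<alpha> e\<^sub>K)\<close> each monomial is a constant times \<open>exp (\<alpha> s)\<close>, where \<open>s\<close> counts its
  variables in \<open>K\<close>. Since the coefficients are positive there is no cancellation, so the limits in
  the definitions of the graph and of the hypergraph only ask which \<open>s\<close> vanish.
\<close>

lemma G_inf_iff: "(i, j) \<in> G_inf d F \<longleftrightarrow> (\<exists>is\<in>row_support d F i. j \<in> set is)"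
proof
  assume edge: "(i, j) \<in> G_inf d F"
  show "\<exists>is\<in>row_support d F i. j \<in> set is"
  proof (rule ccontr)
    assume "\<not> ?thesis"
    then have "(\<Sum>k<d - 1. indicator {j} (is ! k) :: real) = 0" if "is \<in> row_support d F i" for "is"
      using that by (intro sum_indicator_nth_zero) (auto dest: row_supportD)
    then have "tensor_map d F (exp_ray \<alpha> {j}) $ i = (\<Sum>is\<in>row_support d F i. F (i # is))" for \<alpha>
      unfolding tensor_map_exp_ray by (intro sum.cong) auto
    with edge have "filterlim (\<lambda>\<alpha>::real. \<Sum>is\<in>row_support d F i. F (i # is)) at_top at_top"
      by (simp add: G_inf_def)
    then show False
      using not_tendsto_and_filterlim_at_infinity tendsto_const filterlim_at_top_imp_at_infinity
        trivial_limit_at_top_linorder by blast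
  qed
next
  assume "\<exists>is\<in>row_support d F i. j \<in> set is"
  then obtain "is" where "is": "is \<in> row_support d F i" "j \<in> set is"
    by blast
  define s :: real where "s = (\<Sum>k<d - 1. indicator {j} (is ! k))"
  have s: "0 < s"
    unfolding s_def using sum_indicator_nth_pos_iff[OF row_supportD(1)[OF "is"(1)]] "is"(2) by simp
  have "filterlim (\<lambda>\<alpha>. \<alpha> * s) at_top at_top"
    using s filterlim_ident filterlim_at_top_mult_tendsto_pos[OF tendsto_const] by blast
  then have "filterlim (\<lambda>\<alpha>. exp (\<alpha> * s)) at_top at_top"
    by (rule filterlim_compose[OF exp_at_top])
  then have lim: "filterlim (\<lambda>\<alpha>. F (i # is) * exp (\<alpha> * s)) at_top at_top"
    using filterlim_tendsto_pos_mult_at_top[OF tendsto_const row_supportD(2)[OF "is"(1)]] by blast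
  have "F (i # is) * exp (\<alpha> * s) \<le> tensor_map d F (exp_ray \<alpha> {j}) $ i" for \<alpha>
    unfolding s_def tensor_map_exp_ray
    by (rule member_le_sum[OF "is"(1)]) (auto dest: row_supportD less_imp_le)
  then have "filterlim (\<lambda>\<alpha>. tensor_map d F (exp_ray \<alpha> {j}) $ i) at_top at_top"
    by (intro filterlim_at_top_mono[OF lim]) auto
  then show "(i, j) \<in> G_inf d F"
    by (simp add: G_inf_def)
qed

lemma H_inf_iff:
  "(J, h) \<in> H_inf d F \<longleftrightarrow>
     (\<exists>i. h = {i} \<and> J \<noteq> {} \<and> i \<notin> J \<and> (\<forall>is\<in>row_support d F i. J \<inter> set is \<noteq> {}))"
proof -
  have "((\<lambda>\<alpha>. tensor_map d F (exp_ray \<alpha> J) $ i) \<longlongrightarrow> 0) at_bot \<longleftrightarrow>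
      (\<forall>is\<in>row_support d F i. J \<inter> set is \<noteq> {})" for i
  proof
    assume lim: "((\<lambda>\<alpha>. tensor_map d F (exp_ray \<alpha> J) $ i) \<longlongrightarrow> 0) at_bot"
    show "\<forall>is\<in>row_support d F i. J \<inter> set is \<noteq> {}"
    proof (intro ballI notI)
      fix "is" assume "is": "is \<in> row_support d F i" "J \<inter> set is = {}"
      have "F (i # is) \<le> tensor_map d F (exp_ray \<alpha> J) $ i" for \<alpha>
      proof -
        have "F (i # is) = F (i # is) * exp (\<alpha> * (\<Sum>k<d - 1. indicator J (is ! k)))"
          using sum_indicator_nth_zero[OF row_supportD(1)[OF "is"(1)] "is"(2)] by simp
        also have "\<dots> \<le> tensor_map d F (exp_ray \<alpha> J) $ i"
          unfolding tensor_map_exp_ray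
          by (rule member_le_sum[OF "is"(1)]) (auto dest: row_supportD less_imp_le)
        finally show ?thesis .
      qed
      then have "F (i # is) \<le> 0"
        by (intro tendsto_lowerbound[OF lim]) auto
      then show False
        using row_supportD(2)[OF "is"(1)] by simp
    qed
  next
    assume meet: "\<forall>is\<in>row_support d F i. J \<inter> set is \<noteq> {}"
    show "((\<lambda>\<alpha>. tensor_map d F (exp_ray \<alpha> J) $ i) \<longlongrightarrow> 0) at_bot"
      unfolding tensor_map_exp_ray
    proof (rule tendsto_null_sum)
      fix "is" assume "is": "is \<in> row_support d F i"
      define s :: real where "s = (\<Sum>k<d - 1. indicator J (is ! k))"
      have s: "0 < s"
        unfolding s_def using sum_indicator_nth_pos_iff[OF row_supportD(1)[OF "is"]] meet "is" by simp
      have "filterlim (\<lambda>\<alpha>. \<alpha> * s) at_bot at_bot"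
        using filterlim_tendsto_pos_mult_at_bot[OF tendsto_const s filterlim_ident]
        by (simp add: mult.commute)
      then have "((\<lambda>\<alpha>. exp (\<alpha> * s)) \<longlongrightarrow> 0) at_bot"
        by (rule filterlim_compose[OF exp_at_bot])
      then show "((\<lambda>\<alpha>. F (i # is) * exp (\<alpha> * (\<Sum>k<d - 1. indicator J (is ! k)))) \<longlongrightarrow> 0) at_bot"
        unfolding s_def by (rule tendsto_mult_right_zero)
    qed
  qed
  then show ?thesis
    by (auto simp: H_inf_def)
qed

end

section \<open>Final classes of finite graphs\<close>

lemma finite_minimizer:
  fixes g :: "'a \<Rightarrow> 'b::linorder"
  assumes "finite A" "A \<noteq> {}"
  obtains i where "i \<in> A" "\<And>j. j \<in> A \<Longrightarrow> g i \<le> g j"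
  using arg_min_if_finite(1)[OF assms] arg_min_least[OF assms] that by blast

lemma finite_maximizer:
  fixes g :: "'a \<Rightarrow> 'b::linorder"
  assumes "finite A" "A \<noteq> {}"
  obtains i where "i \<in> A" "\<And>j. j \<in> A \<Longrightarrow> g j \<le> g i"
  using obtains_MAX[OF assms, of g] assms by (metis Max_ge finite_imageI imageI)

text \<open>Among the nodes reachable from \<open>i\<close>, one that reaches fewest nodes lies in a final class.\<close>

lemma reaches_final_class:
  fixes E :: "('n::finite \<times> 'n) set"
  obtains C where "final_class E C" "\<exists>j\<in>C. (i, j) \<in> E\<^sup>*"
proof -
  obtain j where j: "(i, j) \<in> E\<^sup>*"
    and min: "\<And>k. (i, k) \<in> E\<^sup>* \<Longrightarrow> card (E\<^sup>* `` {j}) \<le> card (E\<^sup>* `` {k})"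
    using finite_minimizer[of "E\<^sup>* `` {i}" "\<lambda>k. card (E\<^sup>* `` {k})"] by auto
  have returns: "(k, j) \<in> E\<^sup>*" if "(j, k) \<in> E\<^sup>*" for k
  proof -
    have "E\<^sup>* `` {k} \<subseteq> E\<^sup>* `` {j}"
      using that by (auto intro: rtrancl_trans)
    moreover have "card (E\<^sup>* `` {j}) \<le> card (E\<^sup>* `` {k})"
      using that j by (intro min) (rule rtrancl_trans)
    ultimately have "E\<^sup>* `` {k} = E\<^sup>* `` {j}"
      by (intro card_seteq) auto
    then show ?thesis
      by blast
  qed
  have "final_class E (E\<^sup>* `` {j})"
    unfolding final_class_def by (auto intro: rtrancl_trans dest: returns)
  with j show ?thesis
    using that by blast
qed

lemma meeting_final_classes_equal:
  assumes "final_class E C" "final_class E C'" "C \<inter> C' \<noteq> {}"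
  shows "C = C'"
  using assms unfolding final_class_def by blast

lemma reaches_unique_final_class:
  fixes E :: "('n::finite \<times> 'n) set"
  assumes "final_class E C" "\<And>C'. final_class E C' \<Longrightarrow> C' = C" "j \<in> C"
  shows "(i, j) \<in> E\<^sup>*"
proof -
  obtain k where "k \<in> C" "(i, k) \<in> E\<^sup>*"
    using reaches_final_class[of E i] assms(2) by metis
  with assms(1,3) show ?thesis
    unfolding final_class_def by (meson rtrancl_trans)
qed

section \<open>Rescaling rows, and the eigenvalue seen by a closed set\<close>

definition scale_rows :: "'n set \<Rightarrow> real \<Rightarrow> 'n tensor \<Rightarrow> 'n tensor" where
  "scale_rows A t F = (\<lambda>is. if hd is \<in> A then t * F is else F is)"

lemma tensor_map_scale_rows:
  "tensor_map d (scale_rows A t F) x $ i = (if i \<in> A then t else 1) * tensor_map d F x $ i"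
  by (simp add: tensor_map_def scale_rows_def sum_distrib_left mult.assoc)

lemma scale_rows_same_pattern:
  assumes "0 < t" "nonneg_tensor d F"
  shows "nonneg_tensor d (scale_rows A t F)" "pattern d (scale_rows A t F) = pattern d F"
  using assms by (auto simp: scale_rows_def nonneg_tensor_def pattern_def zero_less_mult_iff)

context nonzero_row_tensor
begin

definition row_closed :: "'n set \<Rightarrow> bool" where
  "row_closed C \<longleftrightarrow> (\<forall>i\<in>C. \<forall>is\<in>row_support d F i. set is \<subseteq> C)"

lemma final_class_row_closed:
  assumes "final_class (G_inf d F) C"
  shows "row_closed C"
  unfolding row_closed_def
proof (intro ballI subsetI)
  fix i "is" j assume "i \<in> C" "is \<in> row_support d F i" "j \<in> set is"
  then show "j \<in> C"
    using assms G_inf_iff[of i j] unfolding final_class_def by blast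
qed

text \<open>
  The monotonicity argument of nonlinear Perron-Frobenius theory, localised to a closed set: scale
  \<open>v\<close> by the largest ratio \<open>c\<close> of entries on \<open>C\<close>, so that \<open>u \<le> c v\<close> on \<open>C\<close> with equality at some \<open>i\<close>,
  and compare the \<open>i\<close>-th coordinates.
\<close>

lemma eigenvalue_le:
  assumes C: "C \<noteq> {}" "row_closed C"
    and u: "\<And>i. 0 < u $ i" "\<And>i. i \<in> C \<Longrightarrow> tensor_map d F u $ i = \<rho> * (u $ i) ^ (d - 1)"
    and v: "\<And>i. 0 < v $ i" "\<And>i. i \<in> C \<Longrightarrow> tensor_map d F v $ i = \<mu> * (v $ i) ^ (d - 1)"
  shows "\<rho> \<le> \<mu>"
proof -
  obtain i where i: "i \<in> C" and max: "\<And>j. j \<in> C \<Longrightarrow> u $ j / v $ j \<le> u $ i / v $ i"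
    using finite_maximizer[of C "\<lambda>j. u $ j / v $ j"] C(1) by auto
  define c where "c = u $ i / v $ i"
  have c: "0 < c" "u $ i = c * v $ i" "\<And>j. j \<in> C \<Longrightarrow> u $ j \<le> c * v $ j"
    using u(1)[of i] v(1) max by (auto simp: c_def pos_divide_le_eq less_imp_neq[symmetric])
  have "tensor_map d F u $ i \<le>
      (\<Sum>is\<in>row_support d F i. F (i # is) * (\<Prod>k<d - 1. c * v $ (is ! k)))"
    unfolding tensor_map_row_support
  proof (intro sum_mono mult_left_mono prod_mono conjI)
    fix "is" k assume "is": "is \<in> row_support d F i" and "k \<in> {..<d - 1}"
    then have "is ! k \<in> C"
      using i C(2) row_supportD(1)[OF "is"] by (auto simp: row_closed_def subset_iff)
    then show "u $ (is ! k) \<le> c * v $ (is ! k)"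
      by (rule c(3))
  qed (auto simp: u(1) less_imp_le dest: row_supportD)
  also have "\<dots> = c ^ (d - 1) * tensor_map d F v $ i"
    by (simp add: tensor_map_row_support prod.distrib sum_distrib_left mult.left_commute)
  also have "\<dots> = \<mu> * (u $ i) ^ (d - 1)"
    using i by (simp add: v(2) c(2) power_mult_distrib)
  finally show ?thesis
    using u i by simp
qed

lemma eigenvalue_unique:
  assumes "C \<noteq> {}" "row_closed C"
    and "\<And>i. 0 < u $ i" "\<And>i. i \<in> C \<Longrightarrow> tensor_map d F u $ i = \<rho> * (u $ i) ^ (d - 1)"
    and "\<And>i. 0 < v $ i" "\<And>i. i \<in> C \<Longrightarrow> tensor_map d F v $ i = \<mu> * (v $ i) ^ (d - 1)"
  shows "\<rho> = \<mu>"
  using eigenvalue_le[OF assms(1,2,3,4,5,6)] eigenvalue_le[OF assms(1,2,5,6,3,4)] by simp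

lemma scaled_rows_eigenvector:
  assumes "\<forall>F' :: 'n tensor. nonneg_tensor d F' \<and> pattern d F' = pattern d F \<longrightarrow>
      (\<exists>u. positive_eigenvector d F' u)" and "0 < t"
  obtains u \<rho> where "\<And>i. 0 < u $ i" "0 < \<rho>"
    "\<And>i. (if i \<in> A then t else 1) * tensor_map d F u $ i = \<rho> * (u $ i) ^ (d - 1)"
proof -
  obtain u where "positive_eigenvector d (scale_rows A t F) u"
    using assms scale_rows_same_pattern[OF assms(2) nonneg, of A] by blast
  then show ?thesis
    using that unfolding positive_eigenvector_def tensor_map_scale_rows by blast
qed

text \<open>
  If \<open>v\<close> is an eigenvector for \<open>\<mu>\<close> after the rows in \<open>C\<close> are doubled, then for \<open>F\<close> itself it satisfies
  the eigenvalue equation with \<open>\<mu> / 2\<close> on \<open>C\<close> and with \<open>\<mu>\<close> on a disjoint \<open>C'\<close>. Both would have to equal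
  the eigenvalue of \<open>F\<close>.
\<close>

lemma final_class_unique:
  assumes ev: "\<forall>F' :: 'n tensor. nonneg_tensor d F' \<and> pattern d F' = pattern d F \<longrightarrow>
      (\<exists>u. positive_eigenvector d F' u)"
    and C: "final_class (G_inf d F) C" and C': "final_class (G_inf d F) C'"
  shows "C' = C"
proof (rule ccontr)
  assume "C' \<noteq> C"
  then have disj: "C \<inter> C' = {}"
    using meeting_final_classes_equal[OF C C'] by blast
  obtain u \<rho> where u: "\<And>i. 0 < u $ i" "0 < \<rho>"
      "\<And>i. tensor_map d F u $ i = \<rho> * (u $ i) ^ (d - 1)"
    using scaled_rows_eigenvector[OF ev zero_less_one, of "{}"] by auto
  obtain v \<mu> where v: "\<And>i. 0 < v $ i" "0 < \<mu>"
      "\<And>i. (if i \<in> C then 2 else 1) * tensor_map d F v $ i = \<mu> * (v $ i) ^ (d - 1)"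
    using scaled_rows_eigenvector[OF ev zero_less_numeral, of C] by blast
  have "\<rho> = \<mu> / 2"
  proof (rule eigenvalue_unique[OF _ final_class_row_closed[OF C] u(1) u(3) v(1)])
    show "tensor_map d F v $ i = \<mu> / 2 * (v $ i) ^ (d - 1)" if "i \<in> C" for i
      using v(3)[of i] that by simp
  qed (use C in \<open>simp add: final_class_def\<close>)
  moreover have "\<rho> = \<mu>"
  proof (rule eigenvalue_unique[OF _ final_class_row_closed[OF C'] u(1) u(3) v(1)])
    show "tensor_map d F v $ i = \<mu> * (v $ i) ^ (d - 1)" if "i \<in> C'" for i
      using v(3)[of i] that disj by (auto split: if_splits)
  qed (use C' in \<open>simp add: final_class_def\<close>)
  ultimately show False
    using u(2) by simp
qed

text \<open>
  Otherwise every monomial of row \<open>i\<close> meets the reach, which is then the tail of a hyperarc with head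
  \<open>{i}\<close>. Nonemptiness of \<open>C\<close> enters because tails are nonempty.
\<close>

lemma row_outside_reach:
  assumes "C \<noteq> {}" "i \<notin> reach C (H_inf d F)"
  shows "\<exists>is\<in>row_support d F i. set is \<inter> reach C (H_inf d F) = {}"
proof (rule ccontr)
  assume "\<not> ?thesis"
  moreover have "reach C (H_inf d F) \<noteq> {}"
    using assms(1) reach.start by fastforce
  ultimately have "(reach C (H_inf d F), {i}) \<in> H_inf d F"
    using assms(2) by (auto simp: H_inf_iff Int_commute)
  then have "i \<in> reach C (H_inf d F)"
    by (rule reach.hyperarc) auto
  with assms(2) show False ..
qed

lemma coefficient_bounds:
  obtains a M where "0 < a" "\<And>i is. is \<in> row_support d F i \<Longrightarrow> a \<le> F (i # is)"
    and "\<And>i. (\<Sum>is\<in>row_support d F i. F (i # is)) \<le> M"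
proof -
  define P where "P = (\<Union>i. (\<lambda>is. F (i # is)) ` row_support d F i)"
  define M where "M = Max (range (\<lambda>i. \<Sum>is\<in>row_support d F i. F (i # is)))"
  have "finite P" "P \<noteq> {}" "\<And>p. p \<in> P \<Longrightarrow> 0 < p"
    using row_support_nonempty by (auto simp: P_def dest: row_supportD)
  then have "0 < Min P"
    by simp
  moreover have "Min P \<le> F (i # is)" if "is \<in> row_support d F i" for i "is"
    using that \<open>finite P\<close> by (intro Min_le) (auto simp: P_def)
  moreover have "(\<Sum>is\<in>row_support d F i. F (i # is)) \<le> M" for i
    unfolding M_def by (rule Max_ge) auto
  ultimately show ?thesis
    using that by blast
qed

text \<open>
  The rows in \<open>C\<close> fix the eigenvalue, whereas by \<open>row_outside_reach\<close> the rows outside the reach of \<open>C\<close>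
  bound it below in proportion to the factor by which they are scaled.
\<close>

lemma reach_eq_UNIV:
  assumes ev: "\<forall>F' :: 'n tensor. nonneg_tensor d F' \<and> pattern d F' = pattern d F \<longrightarrow>
      (\<exists>u. positive_eigenvector d F' u)"
    and C: "final_class (G_inf d F) C"
  shows "reach C (H_inf d F) = UNIV"
proof (rule ccontr)
  define S where "S = - reach C (H_inf d F)"
  assume "reach C (H_inf d F) \<noteq> UNIV"
  then have S: "S \<noteq> {}" "C \<inter> S = {}"
    by (auto simp: S_def intro: reach.start)
  have C_ne: "C \<noteq> {}"
    using C by (simp add: final_class_def)
  obtain a where a: "0 < a" "\<And>i is. is \<in> row_support d F i \<Longrightarrow> a \<le> F (i # is)"
    using coefficient_bounds by metis
  obtain u \<rho> where u: "\<And>i. 0 < u $ i" "0 < \<rho>"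
      "\<And>i. tensor_map d F u $ i = \<rho> * (u $ i) ^ (d - 1)"
    using scaled_rows_eigenvector[OF ev zero_less_one, of "{}"] by auto
  \<comment> \<open>any \<open>t\<close> with \<open>t * a > \<rho>\<close> would do\<close>
  define t where "t = 2 * \<rho> / a"
  have t: "0 < t"
    using a(1) u(2) by (simp add: t_def)
  obtain v \<mu> where v: "\<And>i. 0 < v $ i"
      "\<And>i. (if i \<in> S then t else 1) * tensor_map d F v $ i = \<mu> * (v $ i) ^ (d - 1)"
    using scaled_rows_eigenvector[OF ev t, of S] by metis
  have "\<rho> = \<mu>"
  proof (rule eigenvalue_unique[OF C_ne final_class_row_closed[OF C] u(1) u(3) v(1)])
    show "tensor_map d F v $ i = \<mu> * (v $ i) ^ (d - 1)" if "i \<in> C" for i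
      using v(2)[of i] that S(2) by (auto split: if_splits)
  qed
  obtain i where i: "i \<in> S" and min: "\<And>j. j \<in> S \<Longrightarrow> v $ i \<le> v $ j"
    using finite_minimizer[of S "\<lambda>j. v $ j"] S(1) by auto
  obtain "is" where "is": "is \<in> row_support d F i" "set is \<subseteq> S"
    using row_outside_reach[OF C_ne, of i] i by (auto simp: S_def)
  have "a * (v $ i) ^ (d - 1) \<le> F (i # is) * (\<Prod>k<d - 1. v $ (is ! k))"
  proof (rule mult_mono)
    have "(\<Prod>k<d - 1. v $ i) \<le> (\<Prod>k<d - 1. v $ (is ! k))"
      using "is" row_supportD(1)[OF "is"(1)]
      by (intro prod_mono) (auto simp: less_imp_le[OF v(1)] subset_iff intro!: min)
    then show "(v $ i) ^ (d - 1) \<le> (\<Prod>k<d - 1. v $ (is ! k))"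
      by simp
  qed (use a(2)[OF "is"(1)] row_supportD(2)[OF "is"(1)] v(1) in \<open>auto simp: less_imp_le\<close>)
  also have "\<dots> \<le> tensor_map d F v $ i"
    using v(1) "is"(1) by (intro monomial_le_tensor_map) (auto simp: less_imp_le)
  finally have "t * (a * (v $ i) ^ (d - 1)) \<le> \<mu> * (v $ i) ^ (d - 1)"
    using v(2)[of i] i t by (metis mult_left_mono less_imp_le)
  then have "t * a \<le> \<mu>"
    using v(1)[of i] by (simp flip: mult.assoc)
  then show False
    using a(1) u(2) \<open>\<rho> = \<mu>\<close> by (simp add: t_def)
qed

end

section \<open>A priori bounds and a truncated fixed point\<close>

lemma continuous_on_Min_image:
  fixes f :: "'b \<Rightarrow> 'a::topological_space \<Rightarrow> real"
  assumes "finite I" "I \<noteq> {}" "\<And>i. i \<in> I \<Longrightarrow> continuous_on S (f i)"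
  shows "continuous_on S (\<lambda>x. Min ((\<lambda>i. f i x) ` I))"
  using assms
proof (induction rule: finite_ne_induct)
  case (insert i I)
  then have "continuous_on S (\<lambda>x. min (f i x) (Min ((\<lambda>i. f i x) ` I)))"
    by (intro continuous_on_min) auto
  with insert.hyps show ?case
    by simp
qed simp

text \<open>
  Subtracting the smallest entry keeps the image nonnegative and puts a zero into it; cutting off at
  \<open>W\<close> keeps it in a cube. So Brouwer's theorem applies to every continuous map.
\<close>

lemma truncated_fixed_point:
  fixes g :: "real ^ 'n::finite \<Rightarrow> real ^ 'n"
  assumes "continuous_on UNIV g" "0 < W"
  obtains x c where "\<And>i. 0 \<le> x $ i" "\<And>i. x $ i = min (g x $ i - c) W" "\<exists>i. x $ i = 0"
proof -
  define c where "c x = Min (range (\<lambda>i. g x $ i))" for x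
  define h :: "real ^ 'n \<Rightarrow> real ^ 'n" where "h x = (\<chi> i. min (g x $ i - c x) W)" for x
  define Q :: "(real ^ 'n) set" where "Q = cbox 0 (\<chi> i. W)"
  have c_le: "c x \<le> g x $ i" for x i
    by (simp add: c_def)
  have "continuous_on UNIV c"
    unfolding c_def by (intro continuous_on_Min_image continuous_on_component assms(1)) auto
  then have "continuous_on UNIV h"
    unfolding h_def by (intro continuous_intros continuous_on_component assms(1))
  moreover have "h \<in> Q \<rightarrow> Q"
    using c_le assms(2) by (auto simp: h_def Q_def mem_box_cart)
  moreover have "Q \<noteq> {}"
    using assms(2) by (auto simp: Q_def interval_eq_empty_cart not_less less_imp_le)
  ultimately obtain x where x: "x \<in> Q" "h x = x"
    using brouwer[of Q h] continuous_on_subset[of UNIV h Q] by (auto simp: Q_def)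
  have eq: "x $ i = min (g x $ i - c x) W" for i
    using arg_cong[OF x(2), of "\<lambda>y. y $ i"] by (simp add: h_def)
  have "c x \<in> range (\<lambda>i. g x $ i)"
    unfolding c_def by (rule Min_in) auto
  then obtain i where "g x $ i = c x"
    by auto
  then have "x $ i = 0"
    using eq[of i] assms(2) by simp
  then show ?thesis
    using that[of x "c x"] eq x(1) by (auto simp: Q_def mem_box_cart)
qed

context nonzero_row_tensor
begin

text \<open>
  The two halves of the max-plus equation \<open>m x\<^sub>i = max (x\<^sub>i\<^sub>2 + \<dots> + x\<^sub>i\<^sub>d)\<close>, up to an error \<open>K\<close>. The first
  half is required only below the height \<open>W\<close>, which is what a fixed point truncated at \<open>W\<close> provides.
\<close>

definition almost_supersolution :: "real \<Rightarrow> real \<Rightarrow> real ^ 'n \<Rightarrow> bool" where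
  "almost_supersolution K W x \<longleftrightarrow> (\<forall>i. x $ i < W \<longrightarrow>
     (\<forall>is\<in>row_support d F i. (\<Sum>k<d - 1. x $ (is ! k)) \<le> real (d - 1) * x $ i + K))"

definition almost_subsolution :: "real \<Rightarrow> real ^ 'n \<Rightarrow> bool" where
  "almost_subsolution K x \<longleftrightarrow>
     (\<forall>i. \<exists>is\<in>row_support d F i. real (d - 1) * x $ i \<le> (\<Sum>k<d - 1. x $ (is ! k)) + K)"

text \<open>
  One edge: if \<open>x\<^sub>j\<close> is at most \<open>D0 < W\<close>, a monomial of row \<open>j\<close> sums to at most \<open>m D0 + K\<close>, and so does
  each single variable in it because all entries are nonnegative. Bounds are phrased as
  holding for all large \<open>D\<close>, which makes them uniform over finitely many nodes without effort.
\<close>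

lemma bounded_along_path:
  assumes "(i, j) \<in> (G_inf d F)\<^sup>*" "0 \<le> K"
  shows "\<forall>\<^sub>F D in at_top. \<forall>x W. D < W \<longrightarrow> (\<forall>l. 0 \<le> x $ l) \<longrightarrow> almost_supersolution K W x \<longrightarrow>
    x $ i = 0 \<longrightarrow> x $ j \<le> D"
  using assms(1)
proof (induction rule: rtrancl_induct)
  case base
  show ?case
    using eventually_ge_at_top[of 0] by eventually_elim auto
next
  case (step j k)
  obtain D0 where D0: "0 \<le> D0" and bound: "\<And>x W. D0 < W \<Longrightarrow> \<forall>l. 0 \<le> x $ l \<Longrightarrow>
      almost_supersolution K W x \<Longrightarrow> x $ i = 0 \<Longrightarrow> x $ j \<le> D0"
    using eventually_happens[OF eventually_conj[OF eventually_ge_at_top[of 0] step.IH]] by auto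
  obtain "is" where "is": "is \<in> row_support d F j" "k \<in> set is"
    using step.hyps(2) by (auto simp: G_inf_iff)
  have "x $ k \<le> D"
    if D: "D0 + real (d - 1) * D0 + K \<le> D" "D < W" and x: "\<forall>l. 0 \<le> x $ l" "almost_supersolution K W x"
      "x $ i = 0" for D x W
  proof -
    have "0 \<le> real (d - 1) * D0"
      using D0 by simp
    then have "D0 < W"
      using D assms(2) by linarith
    then have j: "x $ j \<le> D0"
      using bound x by blast
    obtain l where l: "l < d - 1" "is ! l = k"
      using "is" row_supportD(1)[OF "is"(1)] by (auto simp: in_set_conv_nth)
    have "x $ k \<le> (\<Sum>l<d - 1. x $ (is ! l))"
      using member_le_sum[of l "{..<d - 1}" "\<lambda>l. x $ (is ! l)"] l x(1) by auto
    also have "\<dots> \<le> real (d - 1) * x $ j + K"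
      using x(2) j \<open>D0 < W\<close> "is"(1) by (auto simp: almost_supersolution_def)
    also have "\<dots> \<le> real (d - 1) * D0 + K"
      using j by (intro add_right_mono mult_left_mono) auto
    finally show ?thesis
      using D(1) D0 by linarith
  qed
  then show ?case
    by (intro eventually_mono[OF eventually_ge_at_top[of "D0 + real (d - 1) * D0 + K"]]) blast
qed

lemma bounded_on_unique_final_class:
  assumes "final_class (G_inf d F) C" "\<And>C'. final_class (G_inf d F) C' \<Longrightarrow> C' = C" "0 \<le> K"
  shows "\<forall>\<^sub>F D in at_top. \<forall>x W. D < W \<longrightarrow> (\<forall>l. 0 \<le> x $ l) \<longrightarrow> (\<exists>i. x $ i = 0) \<longrightarrow>
    almost_supersolution K W x \<longrightarrow> (\<forall>j\<in>C. x $ j \<le> D)"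
proof -
  have "\<forall>\<^sub>F D in at_top. \<forall>i j. j \<in> C \<longrightarrow> (\<forall>x W. D < W \<longrightarrow> (\<forall>l. 0 \<le> x $ l) \<longrightarrow>
      almost_supersolution K W x \<longrightarrow> x $ i = 0 \<longrightarrow> x $ j \<le> D)"
  proof (intro eventually_all_finite)
    fix i j
    show "\<forall>\<^sub>F D in at_top. j \<in> C \<longrightarrow> (\<forall>x W. D < W \<longrightarrow> (\<forall>l. 0 \<le> x $ l) \<longrightarrow>
        almost_supersolution K W x \<longrightarrow> x $ i = 0 \<longrightarrow> x $ j \<le> D)"
    proof (cases "j \<in> C")
      case True
      then show ?thesis
        using bounded_along_path[OF reaches_unique_final_class[OF assms(1,2) True] assms(3)]
        by simp
    qed simp
  qed
  then show ?thesis
    by (rule eventually_mono) blast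
qed

text \<open>
  Following a hyperarc: a monomial that nearly attains \<open>m x\<^sub>i\<close> has one variable in the tail, with the
  improved bound, and \<open>m - 1\<close> others bounded by \<open>X\<close>. Dividing by \<open>m\<close> leaves a gain of \<open>X / (m D0)\<close>
  over the trivial bound \<open>X\<close>. The one parameter \<open>D\<close> serves both as the inverse of the gain and as
  the additive constant, so that the bound weakens as \<open>D\<close> grows.
\<close>

lemma contracted_on_reach:
  assumes "i \<in> reach C (H_inf d F)" "0 \<le> K" "2 \<le> d"
  shows "\<forall>\<^sub>F D in at_top. \<forall>x X. (\<forall>l. 0 \<le> x $ l \<and> x $ l \<le> X) \<longrightarrow> almost_subsolution K x \<longrightarrow>
    (\<forall>j\<in>C. x $ j \<le> B) \<longrightarrow> x $ i \<le> X - X / D + D"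
  using assms(1)
proof (induction rule: reach.induct)
  case (start j)
  show ?case
    using eventually_ge_at_top[of 1] eventually_ge_at_top[of B]
  proof eventually_elim
    case (elim D)
    have "x $ j \<le> X - X / D + D"
      if x: "\<forall>l. 0 \<le> x $ l \<and> x $ l \<le> X" "\<forall>j\<in>C. x $ j \<le> B" for x :: "real ^ 'n" and X
    proof -
      have "0 \<le> X"
        using x(1) by (meson order.trans)
      then have "X / D \<le> X"
        using elim(1) by (simp add: divide_le_eq mult_le_cancel_left1)
      then show ?thesis
        using x(2) start elim(2) by fastforce
    qed
    then show ?case
      by blast
  qed
next
  case (hyperarc t h i)
  then have t: "\<And>is. is \<in> row_support d F i \<Longrightarrow> t \<inter> set is \<noteq> {}"
    by (auto simp: H_inf_iff)
  define bounded_at where "bounded_at k D \<longleftrightarrow> (\<forall>x X. (\<forall>l. 0 \<le> x $ l \<and> x $ l \<le> X) \<longrightarrow>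
      almost_subsolution K x \<longrightarrow> (\<forall>j\<in>C. x $ j \<le> B) \<longrightarrow> x $ k \<le> X - X / D + D)" for k D
  have "\<forall>\<^sub>F D in at_top. \<forall>k\<in>t. bounded_at k D"
    using hyperarc.IH by (intro eventually_ball_finite) (auto simp: bounded_at_def)
  then obtain D0 where D0: "1 \<le> D0" and tail: "\<And>k. k \<in> t \<Longrightarrow> bounded_at k D0"
    using eventually_happens[OF eventually_conj[OF eventually_ge_at_top[of 1]]] by fastforce
  define m where "m = real (d - 1)"
  have m: "1 \<le> m"
    using assms(3) by (simp add: m_def)
  have "x $ i \<le> X - X / D + D"
    if D: "m * D0 + D0 + K \<le> D" and x: "\<forall>l. 0 \<le> x $ l \<and> x $ l \<le> X"
      "almost_subsolution K x" "\<forall>j\<in>C. x $ j \<le> B" for D x X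
  proof -
    have "0 \<le> X"
      using x(1) by (meson order.trans)
    obtain "is" where "is": "is \<in> row_support d F i"
        "m * x $ i \<le> (\<Sum>k<d - 1. x $ (is ! k)) + K"
      using x(2) by (auto simp: almost_subsolution_def m_def)
    obtain k where k: "k < d - 1" "is ! k \<in> t"
      using t[OF "is"(1)] row_supportD(1)[OF "is"(1)] by (auto simp: in_set_conv_nth)
    have "(\<Sum>k<d - 1. x $ (is ! k)) = x $ (is ! k) + (\<Sum>l\<in>{..<d - 1} - {k}. x $ (is ! l))"
      using k(1) by (intro sum.remove) auto
    also have "(\<Sum>l\<in>{..<d - 1} - {k}. x $ (is ! l)) \<le> real (card ({..<d - 1} - {k})) * X"
      using x(1) by (intro sum_bounded_above) auto
    also have "real (card ({..<d - 1} - {k})) = m - 1"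
      using k(1) by (simp add: m_def of_nat_diff)
    also have "x $ (is ! k) \<le> X - X / D0 + D0"
      using tail[OF k(2)] x by (auto simp: bounded_at_def)
    finally have "m * x $ i \<le> m * X - X / D0 + (D0 + K)"
      using "is"(2) by (simp add: algebra_simps)
    then have "x $ i \<le> (m * X - X / D0 + (D0 + K)) / m"
      using m by (simp add: pos_le_divide_eq mult.commute)
    also have "\<dots> = X - X / (m * D0) + (D0 + K) / m"
      using m D0 by (simp add: field_simps)
    also have "\<dots> \<le> X - X / D + D"
    proof -
      have mD: "0 < m * D0" "m * D0 \<le> D"
        using m D0 D assms(2) by auto
      then have "X / D \<le> X / (m * D0)"
        using \<open>0 \<le> X\<close> by (intro divide_left_mono) auto
      moreover have "(D0 + K) / m \<le> (D0 + K) / 1"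
        using m D0 assms(2) by (intro divide_left_mono) auto
      ultimately show ?thesis
        using D mD by simp
    qed
    finally show ?thesis .
  qed
  then show ?case
    by (intro eventually_mono[OF eventually_ge_at_top[of "m * D0 + D0 + K"]]) blast
qed

text \<open>
  At a maximal entry \<open>X\<close>, the inequality \<open>X \<le> X - X / D + D\<close> gives \<open>X \<le> D\<^sup>2\<close>. The constants \<open>B\<close> and
  \<open>D\<close> depend neither on \<open>x\<close> nor on \<open>W\<close>, so \<open>W\<close> may be chosen above both \<open>B\<close> and \<open>D\<^sup>2\<close>.
\<close>

lemma a_priori_bound:
  assumes "final_class (G_inf d F) C" "\<And>C'. final_class (G_inf d F) C' \<Longrightarrow> C' = C"
    and "reach C (H_inf d F) = UNIV" "0 \<le> K" "2 \<le> d"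
  obtains W where "0 < W"
    "\<And>x i. \<forall>l. 0 \<le> x $ l \<Longrightarrow> \<exists>l. x $ l = 0 \<Longrightarrow> almost_supersolution K W x \<Longrightarrow> almost_subsolution K x
       \<Longrightarrow> x $ i < W"
proof -
  obtain B where B: "\<And>x W. B < W \<Longrightarrow> \<forall>l. 0 \<le> x $ l \<Longrightarrow> \<exists>l. x $ l = 0 \<Longrightarrow>
      almost_supersolution K W x \<Longrightarrow> \<forall>j\<in>C. x $ j \<le> B"
    using eventually_happens[OF bounded_on_unique_final_class[OF assms(1,2,4)]] by auto
  have "\<forall>\<^sub>F D in at_top. 1 \<le> D \<and> (\<forall>i x X. (\<forall>l. 0 \<le> x $ l \<and> x $ l \<le> X) \<longrightarrow>
      almost_subsolution K x \<longrightarrow> (\<forall>j\<in>C. x $ j \<le> B) \<longrightarrow> x $ i \<le> X - X / D + D)"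
    by (intro eventually_conj eventually_ge_at_top eventually_all_finite contracted_on_reach)
      (auto simp: assms(3-5))
  then obtain D where D: "1 \<le> D" and contr: "\<And>i x X. \<forall>l. 0 \<le> x $ l \<and> x $ l \<le> X \<Longrightarrow>
      almost_subsolution K x \<Longrightarrow> \<forall>j\<in>C. x $ j \<le> B \<Longrightarrow> x $ i \<le> X - X / D + D"
    using eventually_happens'[OF trivial_limit_at_top_linorder] by blast
  define W where "W = max B (D * D) + 1"
  have "0 < W" "B < W" "D * D < W"
    using D mult_mono[of 1 D 1 D] by (auto simp: W_def)
  moreover have "x $ i < W"
    if x: "\<forall>l. 0 \<le> x $ l" "\<exists>l. x $ l = 0" "almost_supersolution K W x" "almost_subsolution K x" for x i
  proof -
    obtain k where k: "\<And>l. x $ l \<le> x $ k"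
      using finite_maximizer[of UNIV "\<lambda>l. x $ l"] by auto
    have "x $ k \<le> x $ k - x $ k / D + D"
      using contr[of x "x $ k"] x(1,4) k B[OF \<open>B < W\<close> x(1-3)] by blast
    then have "x $ k \<le> D * D"
      using D by (simp add: pos_divide_le_eq)
    then show ?thesis
      using k[of i] \<open>D * D < W\<close> by linarith
  qed
  ultimately show ?thesis
    using that by blast
qed

lemma tensor_map_exp_vec_le_monomial:
  assumes "\<And>i. (\<Sum>is\<in>row_support d F i. F (i # is)) \<le> M"
  obtains "is" where "is \<in> row_support d F i"
    "tensor_map d F (exp_vec x) $ i \<le> M * exp (\<Sum>k<d - 1. x $ (is ! k))"
proof -
  obtain "is" where "is": "is \<in> row_support d F i"
    and max: "\<And>js. js \<in> row_support d F i \<Longrightarrow>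
      (\<Sum>k<d - 1. x $ (js ! k)) \<le> (\<Sum>k<d - 1. x $ (is ! k))"
    using finite_maximizer[of "row_support d F i" "\<lambda>is. \<Sum>k<d - 1. x $ (is ! k)"]
      row_support_nonempty[of i] by auto
  have "tensor_map d F (exp_vec x) $ i \<le>
      (\<Sum>js\<in>row_support d F i. F (i # js) * exp (\<Sum>k<d - 1. x $ (is ! k)))"
    unfolding tensor_map_exp_vec
    by (intro sum_mono mult_left_mono) (use max in \<open>auto dest: row_supportD less_imp_le\<close>)
  also have "\<dots> \<le> M * exp (\<Sum>k<d - 1. x $ (is ! k))"
    using assms[of i] by (simp flip: sum_distrib_right)
  finally show ?thesis
    using that "is" by blast
qed

text \<open>
  Truncating at the height \<open>W\<close> of \<open>a_priori_bound\<close> gives a point \<open>x\<close> and a constant \<open>c\<close>; if \<open>x\<close> stays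
  below \<open>W\<close>, then \<open>T x = m x + m c\<close>, that is, \<open>exp x\<close> is an eigenvector with eigenvalue \<open>exp (m c)\<close>.
  What remains is to bound \<open>m c\<close> between \<open>ln a\<close> and \<open>ln M\<close>, so that the error \<open>K = ln M - ln a\<close> suffices
  whatever \<open>W\<close> is.
\<close>

lemma positive_eigenvector_exists:
  assumes "final_class (G_inf d F) C" "\<And>C'. final_class (G_inf d F) C' \<Longrightarrow> C' = C"
    and "reach C (H_inf d F) = UNIV" "2 \<le> d"
  obtains u where "positive_eigenvector d F u"
proof -
  obtain a M where a: "0 < a" "\<And>i is. is \<in> row_support d F i \<Longrightarrow> a \<le> F (i # is)"
    and M: "\<And>i. (\<Sum>is\<in>row_support d F i. F (i # is)) \<le> M"
    using coefficient_bounds by metis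
  have "a \<le> M"
  proof -
    fix i
    obtain "is" where "is \<in> row_support d F i"
      using row_support_nonempty by blast
    then have "F (i # is) \<le> (\<Sum>is\<in>row_support d F i. F (i # is))"
      by (rule member_le_sum) (auto dest: row_supportD less_imp_le)
    then show ?thesis
      using a(2)[OF \<open>is \<in> _\<close>] M[of i] by linarith
  qed
  define K where "K = ln M - ln a"
  have K: "0 \<le> K"
    using \<open>a \<le> M\<close> a(1) by (simp add: K_def)
  define m where "m = real (d - 1)"
  have m: "0 < m"
    using assms(4) by (simp add: m_def)
  define T where "T x i = ln (tensor_map d F (exp_vec x) $ i)" for x i
  obtain W where W: "0 < W" "\<And>x i. \<forall>l. 0 \<le> x $ l \<Longrightarrow> \<exists>l. x $ l = 0 \<Longrightarrow> almost_supersolution K W x \<Longrightarrow>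
      almost_subsolution K x \<Longrightarrow> x $ i < W"
    using a_priori_bound[OF assms(1-3) K assms(4)] by metis
  have "continuous_on UNIV (\<lambda>x. T x i)" for i
    unfolding T_def
  proof (rule continuous_on_ln)
    show "continuous_on UNIV (\<lambda>x. tensor_map d F (exp_vec x) $ i)"
      unfolding tensor_map_exp_vec by (intro continuous_intros)
    show "\<forall>x\<in>UNIV. tensor_map d F (exp_vec x) $ i \<noteq> 0"
      using tensor_map_exp_vec_pos[of _ i] by (metis less_irrefl)
  qed
  then have "continuous_on UNIV (\<lambda>x. \<chi> i. T x i / m)"
    using m by (intro continuous_on_vec_lambda continuous_intros) auto
  then obtain x c where x: "\<And>i. 0 \<le> x $ i" 
      "\<And>i. x $ i = min ((\<chi> i. T x i / m) $ i - c) W" "\<exists>i. x $ i = 0"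
    by (rule truncated_fixed_point[OF _ W(1)]) blast
  note x = x[unfolded vec_lambda_beta]
  have T_ge: "ln a + (\<Sum>k<d - 1. x $ (is ! k)) \<le> T x i" if "is \<in> row_support d F i" for i "is"
  proof -
    have "a * exp (\<Sum>k<d - 1. x $ (is ! k)) \<le> F (i # is) * exp (\<Sum>k<d - 1. x $ (is ! k))"
      using a(2)[OF that] by simp
    also have "\<dots> \<le> tensor_map d F (exp_vec x) $ i"
      unfolding tensor_map_exp_vec
      by (rule member_le_sum[OF that]) (auto dest: row_supportD less_imp_le)
    finally have "ln (a * exp (\<Sum>k<d - 1. x $ (is ! k))) \<le> T x i"
      unfolding T_def using a(1) tensor_map_exp_vec_pos[of x i] by simp
    then show ?thesis
      using a(1) by (simp add: ln_mult)
  qed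
  have T_le: "\<exists>is\<in>row_support d F i. T x i \<le> ln M + (\<Sum>k<d - 1. x $ (is ! k))" for i
  proof -
    obtain "is" where "is": "is \<in> row_support d F i"
      "tensor_map d F (exp_vec x) $ i \<le> M * exp (\<Sum>k<d - 1. x $ (is ! k))"
      using tensor_map_exp_vec_le_monomial[OF M] by metis
    then have "T x i \<le> ln (M * exp (\<Sum>k<d - 1. x $ (is ! k)))"
      unfolding T_def using tensor_map_exp_vec_pos[of x i] by (simp add: ln_mono)
    then show ?thesis
      using "is"(1) \<open>a \<le> M\<close> a(1) by (auto simp: ln_mult)
  qed
  have le: "m * x $ i \<le> T x i - m * c" for i
  proof -
    have "x $ i \<le> T x i / m - c"
      using x(2)[of i] by linarith
    then show ?thesis
      using m by (simp add: field_simps)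
  qed
  have eq: "m * x $ i = T x i - m * c" if "x $ i < W" for i
  proof -
    have "x $ i = T x i / m - c"
      using x(2)[of i] that by linarith
    then show ?thesis
      using m by (simp add: field_simps)
  qed
  \<comment> \<open>at a zero entry nothing is cut off, and all monomials are at least 1\<close>
  have c_ge: "ln a \<le> m * c"
  proof -
    obtain i where "x $ i = 0"
      using x(3) by blast
    then have "T x i = m * c"
      using eq[of i] W(1) by simp
    moreover obtain "is" where "is \<in> row_support d F i"
      using row_support_nonempty by blast
    ultimately show ?thesis
      using T_ge[of "is" i] sum_nonneg[of "{..<d - 1}" "\<lambda>k. x $ (is ! k)"] x(1) by fastforce
  qed
  \<comment> \<open>at a maximal entry no monomial exceeds \<open>exp (m x\<^sub>i)\<close>\<close>
  have c_le: "m * c \<le> ln M"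
  proof -
    obtain i where i: "\<And>l. x $ l \<le> x $ i"
      using finite_maximizer[of UNIV "\<lambda>l. x $ l"] by auto
    obtain "is" where "T x i \<le> ln M + (\<Sum>k<d - 1. x $ (is ! k))"
      using T_le by blast
    also have "(\<Sum>k<d - 1. x $ (is ! k)) \<le> m * x $ i"
      using sum_bounded_above[of "{..<d - 1}" "\<lambda>k. x $ (is ! k)"] i by (simp add: m_def)
    finally show ?thesis
      using le[of i] by linarith
  qed
  have "almost_supersolution K W x"
    unfolding almost_supersolution_def
  proof (intro allI impI ballI)
    fix i "is" assume "x $ i < W" "is \<in> row_support d F i"
    then show "(\<Sum>k<d - 1. x $ (is ! k)) \<le> real (d - 1) * x $ i + K"
      using T_ge[of "is" i] eq[of i] c_le by (simp add: K_def m_def)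
  qed
  moreover have "almost_subsolution K x"
    unfolding almost_subsolution_def
  proof
    fix i
    obtain "is" where "is": "is \<in> row_support d F i" "T x i \<le> ln M + (\<Sum>k<d - 1. x $ (is ! k))"
      using T_le by blast
    then have "real (d - 1) * x $ i \<le> (\<Sum>k<d - 1. x $ (is ! k)) + K"
      using le[of i] c_ge by (simp add: K_def m_def)
    then show "\<exists>is\<in>row_support d F i. real (d - 1) * x $ i \<le> (\<Sum>k<d - 1. x $ (is ! k)) + K"
      using "is"(1) by blast
  qed
  ultimately have "x $ i < W" for i
    using W(2) x(1,3) by blast
  then have "T x i = m * c + m * x $ i" for i
    using eq[of i] by simp
  then have "tensor_map d F (exp_vec x) $ i = exp (m * c + m * x $ i)" for i
    using tensor_map_exp_vec_pos[of x i] unfolding T_def by (metis exp_ln)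
  then have "tensor_map d F (exp_vec x) $ i = exp (m * c) * (exp_vec x $ i) ^ (d - 1)" for i
    by (simp add: exp_add exp_vec_def m_def exp_of_nat_mult)
  then have "positive_eigenvector d F (exp_vec x)"
    unfolding positive_eigenvector_def by (auto simp: exp_vec_def intro!: exI[of _ "exp (m * c)"])
  then show ?thesis
    by (rule that)
qed

text \<open>
  In order 1 the map is constant and the degree \<open>m = 0\<close> cannot be divided out. But then the graph has
  no edges, each node is a final class, and uniqueness leaves a single node.
\<close>

lemma positive_eigenvector_exists_order_1:
  assumes "\<And>C'. final_class (G_inf d F) C' \<Longrightarrow> C' = C" "d = 1"
  obtains u where "positive_eigenvector d F u"
proof -
  have "j \<notin> set is" if "is \<in> row_support d F i" for i j "is"
    using row_supportD(1)[OF that] assms(2) by simp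
  then have "(i, j) \<notin> G_inf d F" for i j
    unfolding G_inf_iff by blast
  then have "G_inf d F = {}"
    by auto
  then have "final_class (G_inf d F) {i}" for i
    by (simp add: final_class_def)
  then have one: "i = j" for i j :: 'n
    using assms(1) by (metis singleton_inject)
  fix i
  have "tensor_map d F (exp_vec 0) $ j =
      tensor_map d F (exp_vec 0) $ i * (exp_vec 0 $ j) ^ (d - 1)" for j
    using one[of i j] assms(2) by simp
  then have "positive_eigenvector d F (exp_vec 0)"
    unfolding positive_eigenvector_def using tensor_map_exp_vec_pos[of 0 i]
    by (auto simp: exp_vec_def)
  then show ?thesis
    by (rule that)
qed

end

theorem corollary5p3:
  fixes d :: nat and F :: "'n::finite tensor"
  assumes "d \<ge> 1"
    and "nonneg_tensor d F"
    and "no_zero_row d F"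
  shows "(\<forall>F' :: 'n tensor. nonneg_tensor d F' \<and> pattern d F' = pattern d F \<longrightarrow>
            (\<exists>u. positive_eigenvector d F' u)) \<longleftrightarrow>
         (\<exists>C. final_class (G_inf d F) C \<and>
            (\<forall>C'. final_class (G_inf d F) C' \<longrightarrow> C' = C) \<and>
            reach C (H_inf d F) = UNIV)"
    (is "?eigenvectors \<longleftrightarrow> ?structure")
proof
  interpret nonzero_row_tensor d F
    using assms by unfold_locales
  assume ev: ?eigenvectors
  obtain C where "final_class (G_inf d F) C"
    using reaches_final_class by metis
  then show ?structure
    using final_class_unique[OF ev] reach_eq_UNIV[OF ev] by blast
next
  assume ?structure
  then obtain C where C: "final_class (G_inf d F) C"
      "\<And>C'. final_class (G_inf d F) C' \<Longrightarrow> C' = C" "reach C (H_inf d F) = UNIV"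
    by blast
  show ?eigenvectors
  proof (intro allI impI)
    fix F' :: "'n tensor"
    assume F': "nonneg_tensor d F' \<and> pattern d F' = pattern d F"
    interpret F: nonzero_row_tensor d F
      using assms by unfold_locales
    interpret F': nonzero_row_tensor d F'
      using assms F' by unfold_locales (auto simp: no_zero_row_def)
    have "row_support d F' = row_support d F"
      using F' by (simp add: row_support_def fun_eq_iff)
    then have "G_inf d F' = G_inf d F" "H_inf d F' = H_inf d F"
      by (auto simp: F.G_inf_iff F'.G_inf_iff F.H_inf_iff F'.H_inf_iff)
    note C' = C[folded this]
    show "\<exists>u. positive_eigenvector d F' u"
    proof (cases "d = 1")
      case True
      then show ?thesis
        using F'.positive_eigenvector_exists_order_1[OF C'(2)] by blast
    next
      case False
      then have "2 \<le> d"
        using assms(1) by simp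
      then show ?thesis
        using F'.positive_eigenvector_exists[OF C'] by blast
    qed
  qed
qed

end
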